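(* Let $K$ be a subset of $L^1$. Then $K$ is uniformly integrable if and only if both of the following hold: (i) $\{\mathcal{E}(|X|)\}_{X\in K}$ is bounded; (ii) for any $\epsilon>0$ there is a $\delta>0$ such that for all $A\in\mathcal{F}$ with $\mathcal{E}(I_A)\le\delta$ we have $\mathcal{E}(I_A|X|)<\epsilon$ for all $X\in K$.
   Context: Let $(\Omega,\mathcal{F})$ be a measurable space with a discrete-time filtration $\{\mathcal{F}_t\}_{t\in\mathbb{N}}$, $\mathbb{N}=\{0,1,2,\dots\}$, such that $\mathcal{F}=\mathcal{F}_\infty=\sigma(\bigcup_t\mathcal{F}_t)$ and $\mathcal{F}_0$ is trivial. $m\mathcal{F}_t$ denotes the $\mathcal{F}_t$-measurable $\mathbb{R}\cup\{\pm\infty\}$-valued functions. $\mathcal{H}$ is a linear space of $\mathcal{F}$-measurable $\mathbb{R}$-valued functions on $\Omega$ containing the constants, such that $X\in\mathcal{H}$ implies $|X|\in\mathcal{H}$ and $I_AX\in\mathcal{H}$ for all $A\in\mathcal{F}$; $\mathcal{H}_t:=\mathcal{H}\cap m\mathcal{F}_t$. $\mathcal{E}$ is an $\mathcal{SL}$-expectation: a family of maps $\mathcal{E}_t:\mathcal{H}\to\mathcal{H}_t$ such that for all $X,Y\in\mathcal{H}$, $s\le t$: (i) $X\ge Y$ implies $\mathcal{E}_t(X)\ge\mathcal{E}_t(Y)$; (ii) $\mathcal{E}_s(Y)=\mathcal{E}_s(\mathcal{E}_t(Y))$; (iii) $\mathcal{E}_t(I_AY)=I_A\mathcal{E}_t(Y)$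 for $A\in\mathcal{F}_t$; (iv) $\mathcal{E}_t(Y)=Y$ for $Y\in\mathcal{H}_t$; (v) $\mathcal{E}_t(X+Y)\le\mathcal{E}_t(X)+\mathcal{E}_t(Y)$; (vi) $\mathcal{E}_t(\lambda Y)=\lambda^+\mathcal{E}_t(Y)+\lambda^-\mathcal{E}_t(-Y)$ for $\lambda\in\mathcal{H}_t$ with $\lambda Y\in\mathcal{H}$; (vii) if $X_i\in\mathcal{H}$ and $X_i(\omega)\downarrow0$ for every $\omega$, then $\mathcal{E}_0(X_i)\to0$. Write $\mathcal{E}=\mathcal{E}_0$ (real-valued). Such $\mathcal{E}$ has a representation $\mathcal{E}(Y)=\sup_{\theta\in\Theta}E_\theta[Y]$ for a collection $\Theta$ of ($\sigma$-additive) probability measures. $L^1$ is the completion of $\{X\in\mathcal{H}:\mathcal{E}(|X|)<\infty\}$ under the seminorm $\|X\|_1=\mathcal{E}(|X|)$, modulo equality in $\|\cdot\|_1$; its elements are regarded as $\mathcal{F}$-measurable functions, and $\mathcal{E}$ extends to it by continuity (the extension equals $\sup_{\theta\in\Theta}E_\theta[\cdot]$). A set $K\subset L^1$ is uniformly integrable if $\mathcal{E}(I_{\{|X|\ge c\}}|X|)\to0$ uniformly in $X\in K$ as $c\to\infty$. *)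

theory Defs
  imports "HOL-Probability.Stopping_Time"
begin

(* A function on the sample space is represented by a total function, only the values on the
   sample space \<Omega> being relevant.  The family F provides sigma-algebras only: the measures
   carried by the F t are never used. *)

locale SL_expectation = filtration \<Omega> F
  for \<Omega> :: "'a set" and F :: "nat \<Rightarrow> 'a measure" +
  fixes H :: "('a \<Rightarrow> real) set"
    and \<E> :: "nat \<Rightarrow> ('a \<Rightarrow> real) \<Rightarrow> 'a \<Rightarrow> real"
  assumes nonempty: "\<Omega> \<noteq> {}"
    and F_0_trivial: "sets (F 0) = {{}, \<Omega>}"
    and H_measurable: "X \<in> H \<Longrightarrow> X \<in> borel_measurable (sigma \<Omega> (\<Union>t. sets (F t)))"
    and H_const: "(\<lambda>_. c) \<in> H"
    and H_add: "X \<in> H \<Longrightarrow> Y \<in> H \<Longrightarrow> (\<lambda>\<omega>. X \<omega> + Y \<omega>) \<in> H"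
    and H_scale: "X \<in> H \<Longrightarrow> (\<lambda>\<omega>. c * X \<omega>) \<in> H"
    and H_abs: "X \<in> H \<Longrightarrow> (\<lambda>\<omega>. \<bar>X \<omega>\<bar>) \<in> H"
    and H_indicator: "X \<in> H \<Longrightarrow> A \<in> sets (sigma \<Omega> (\<Union>t. sets (F t))) \<Longrightarrow>
          (\<lambda>\<omega>. indicator A \<omega> * X \<omega>) \<in> H"
    and E_in: "X \<in> H \<Longrightarrow> \<E> t X \<in> H \<inter> borel_measurable (F t)"
    and E_mono: "X \<in> H \<Longrightarrow> Y \<in> H \<Longrightarrow> (\<And>\<omega>. \<omega> \<in> \<Omega> \<Longrightarrow> Y \<omega> \<le> X \<omega>) \<Longrightarrow>
          \<omega> \<in> \<Omega> \<Longrightarrow> \<E> t Y \<omega> \<le> \<E> t X \<omega>"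
    and E_tower: "Y \<in> H \<Longrightarrow> s \<le> t \<Longrightarrow> \<omega> \<in> \<Omega> \<Longrightarrow> \<E> s Y \<omega> = \<E> s (\<E> t Y) \<omega>"
    and E_indicator: "Y \<in> H \<Longrightarrow> A \<in> sets (F t) \<Longrightarrow> \<omega> \<in> \<Omega> \<Longrightarrow>
          \<E> t (\<lambda>\<omega>'. indicator A \<omega>' * Y \<omega>') \<omega> = indicator A \<omega> * \<E> t Y \<omega>"
    and E_adapted: "Y \<in> H \<Longrightarrow> Y \<in> borel_measurable (F t) \<Longrightarrow> \<omega> \<in> \<Omega> \<Longrightarrow> \<E> t Y \<omega> = Y \<omega>"
    and E_subadd: "X \<in> H \<Longrightarrow> Y \<in> H \<Longrightarrow> \<omega> \<in> \<Omega> \<Longrightarrow>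
          \<E> t (\<lambda>\<omega>'. X \<omega>' + Y \<omega>') \<omega> \<le> \<E> t X \<omega> + \<E> t Y \<omega>"
    and E_homogeneous: "Y \<in> H \<Longrightarrow> l \<in> H \<Longrightarrow> l \<in> borel_measurable (F t) \<Longrightarrow>
          (\<lambda>\<omega>'. l \<omega>' * Y \<omega>') \<in> H \<Longrightarrow> \<omega> \<in> \<Omega> \<Longrightarrow>
          \<E> t (\<lambda>\<omega>'. l \<omega>' * Y \<omega>') \<omega>
            = max (l \<omega>) 0 * \<E> t Y \<omega> + max (- l \<omega>) 0 * \<E> t (\<lambda>\<omega>'. - Y \<omega>') \<omega>"
    and E_continuous: "(\<And>i. Xs i \<in> H) \<Longrightarrow> (\<And>\<omega>. \<omega> \<in> \<Omega> \<Longrightarrow> decseq (\<lambda>i. Xs i \<omega>)) \<Longrightarrow>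
          (\<And>\<omega>. \<omega> \<in> \<Omega> \<Longrightarrow> (\<lambda>i. Xs i \<omega>) \<longlonglongrightarrow> 0) \<Longrightarrow> \<omega> \<in> \<Omega> \<Longrightarrow> (\<lambda>i. \<E> 0 (Xs i) \<omega>) \<longlonglongrightarrow> 0"
begin

definition M :: "'a measure" where
  "M = sigma \<Omega> (\<Union>t. sets (F t))"

(* Since F 0 is trivial, \<E> 0 X is constant on \<Omega>. *)
definition E :: "('a \<Rightarrow> real) \<Rightarrow> real" where
  "E X = (THE c. \<forall>\<omega>\<in>\<Omega>. \<E> 0 X \<omega> = c)"

(* A concrete model of the completion of H under the seminorm E |X|: its elements are the
   M-measurable functions X that are limits, outside a set N with E (indicator N) = 0, of a
   Cauchy sequence in H.  E is real-valued, so E |X| < \<infinity> holds for all X in H.  No quotient is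
   taken: two functions stand for the same element iff they agree outside such an N.  By
   Cauchy_represents, every Cauchy sequence in H determines an element.  Values are extended
   real; they are infinite at most on such an N (represents_finite). *)
definition represents :: "(nat \<Rightarrow> 'a \<Rightarrow> real) \<Rightarrow> ('a \<Rightarrow> ereal) \<Rightarrow> bool" where
  "represents Xs X \<longleftrightarrow>
     (\<forall>n. Xs n \<in> H) \<and>
     (\<forall>e>0. \<exists>k. \<forall>m\<ge>k. \<forall>n\<ge>k. E (\<lambda>\<omega>. \<bar>Xs m \<omega> - Xs n \<omega>\<bar>) < e) \<and>
     (\<exists>N\<in>sets M. E (indicator N) = 0 \<and> (\<forall>\<omega>\<in>\<Omega> - N. (\<lambda>n. ereal (Xs n \<omega>)) \<longlonglongrightarrow> X \<omega>))"

definition L1 :: "('a \<Rightarrow> ereal) set" where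
  "L1 = {X \<in> borel_measurable M. \<exists>Xs. represents Xs X}"

(* The extension of E to L1 by continuity; by represents_limit, E1 X is the limit of
   E (Xs n) for every sequence Xs representing X. *)
definition E1 :: "('a \<Rightarrow> ereal) \<Rightarrow> real" where
  "E1 X = (THE l. \<exists>Xs. represents Xs X \<and> (\<lambda>n. E (Xs n)) \<longlonglongrightarrow> l)"

definition uniformly_integrable :: "('a \<Rightarrow> ereal) set \<Rightarrow> bool" where
  "uniformly_integrable K \<longleftrightarrow>
     uniform_limit K (\<lambda>(c::real) X. E1 (\<lambda>\<omega>. indicator {\<omega>\<in>\<Omega>. \<bar>X \<omega>\<bar> \<ge> ereal c} \<omega> * \<bar>X \<omega>\<bar>))
       (\<lambda>_. 0) at_top"

lemma space_M [simp]: "space M = \<Omega>"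
  unfolding M_def using sets.sets_into_space[of _ "F _"]
  by (intro space_measure_of) (auto simp: space_F)

lemma HD [measurable_dest]: "X \<in> H \<Longrightarrow> X \<in> borel_measurable M"
  using H_measurable unfolding M_def by auto

lemma H_ind: "X \<in> H \<Longrightarrow> A \<in> sets M \<Longrightarrow> (\<lambda>\<omega>. indicator A \<omega> * X \<omega>) \<in> H"
  using H_indicator unfolding M_def by auto

lemma indicator_H: "A \<in> sets M \<Longrightarrow> indicator A \<in> H"
  using H_ind[of "\<lambda>_. 1" A] H_const by simp

lemma H_diff: "X \<in> H \<Longrightarrow> Y \<in> H \<Longrightarrow> (\<lambda>\<omega>. X \<omega> - Y \<omega>) \<in> H"
  using H_add[of X "\<lambda>\<omega>. (-1) * Y \<omega>"] H_scale[of Y "-1"] by simp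

lemma H_absdiff: "X \<in> H \<Longrightarrow> Y \<in> H \<Longrightarrow> (\<lambda>\<omega>. \<bar>X \<omega> - Y \<omega>\<bar>) \<in> H"
  by (intro H_abs H_diff)

lemma E_eq:
  assumes "X \<in> H" "\<omega> \<in> \<Omega>"
  shows "\<E> 0 X \<omega> = E X"
proof -
  have m: "\<E> 0 X \<in> borel_measurable (F 0)" using E_in[OF assms(1)] by blast
  have "\<E> 0 X -` {\<E> 0 X \<omega>} \<inter> space (F 0) \<in> sets (F 0)"
    by (rule measurable_sets[OF m]) simp
  then have "\<E> 0 X -` {\<E> 0 X \<omega>} \<inter> \<Omega> \<in> {{}, \<Omega>}" by (simp only: F_0_trivial space_F)
  then have "\<forall>\<omega>'\<in>\<Omega>. \<E> 0 X \<omega>' = \<E> 0 X \<omega>" using assms(2) by blast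
  then have "E X = \<E> 0 X \<omega>" unfolding E_def
    by (rule the_equality) (use assms(2) in fastforce)
  then show ?thesis by simp
qed

lemma mono: "X \<in> H \<Longrightarrow> Y \<in> H \<Longrightarrow> (\<And>\<omega>. \<omega> \<in> \<Omega> \<Longrightarrow> X \<omega> \<le> Y \<omega>) \<Longrightarrow> E X \<le> E Y"
proof -
  assume a: "X \<in> H" "Y \<in> H" "\<And>\<omega>. \<omega> \<in> \<Omega> \<Longrightarrow> X \<omega> \<le> Y \<omega>"
  obtain \<omega> where w: "\<omega> \<in> \<Omega>" using nonempty by blast
  show ?thesis using E_mono[OF a(2,1,3) w, where t = 0] unfolding E_eq[OF a(1) w] E_eq[OF a(2) w] by simp
qed

lemma subadd: "X \<in> H \<Longrightarrow> Y \<in> H \<Longrightarrow> E (\<lambda>\<omega>. X \<omega> + Y \<omega>) \<le> E X + E Y"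
proof -
  assume a: "X \<in> H" "Y \<in> H"
  obtain \<omega> where w: "\<omega> \<in> \<Omega>" using nonempty by blast
  show ?thesis using E_subadd[OF a w, where t = 0]
    unfolding E_eq[OF a(1) w] E_eq[OF a(2) w] E_eq[OF H_add[OF a] w] .
qed

lemma const: "E (\<lambda>_. c) = c"
proof -
  obtain \<omega> where w: "\<omega> \<in> \<Omega>" using nonempty by blast
  show ?thesis using E_adapted[OF H_const[of c] _ w, where t = 0] unfolding E_eq[OF H_const w] by simp
qed

lemma scale: "X \<in> H \<Longrightarrow> c \<ge> 0 \<Longrightarrow> E (\<lambda>\<omega>. c * X \<omega>) = c * E X"
proof -
  assume a: "X \<in> H" "c \<ge> 0"
  obtain \<omega> where w: "\<omega> \<in> \<Omega>" using nonempty by blast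
  show ?thesis using E_homogeneous[OF a(1) H_const[of c] _ H_scale[OF a(1)] w, where t = 0] a(2)
    unfolding E_eq[OF a(1) w] E_eq[OF H_scale[OF a(1)] w] by simp
qed

lemma cont:
  assumes "\<And>i. Xs i \<in> H" "\<And>\<omega>. \<omega> \<in> \<Omega> \<Longrightarrow> decseq (\<lambda>i. Xs i \<omega>)"
    "\<And>\<omega>. \<omega> \<in> \<Omega> \<Longrightarrow> (\<lambda>i. Xs i \<omega>) \<longlonglongrightarrow> 0"
  shows "(\<lambda>i. E (Xs i)) \<longlonglongrightarrow> 0"
proof -
  obtain \<omega> where "\<omega> \<in> \<Omega>" using nonempty by blast
  then show ?thesis using E_continuous[OF assms, of \<omega>] E_eq assms(1) by simp
qed

lemma nonneg: "X \<in> H \<Longrightarrow> (\<And>\<omega>. \<omega> \<in> \<Omega> \<Longrightarrow> 0 \<le> X \<omega>) \<Longrightarrow> 0 \<le> E X"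
  using mono[of "\<lambda>_. 0" X] const H_const by simp

lemma lipschitz:
  assumes "X \<in> H" "Y \<in> H"
  shows "\<bar>E X - E Y\<bar> \<le> E (\<lambda>\<omega>. \<bar>X \<omega> - Y \<omega>\<bar>)"
proof -
  have *: "E X \<le> E Y + E (\<lambda>\<omega>. \<bar>X \<omega> - Y \<omega>\<bar>)" if "X \<in> H" "Y \<in> H" for X Y
  proof -
    have "E X \<le> E (\<lambda>\<omega>. Y \<omega> + \<bar>X \<omega> - Y \<omega>\<bar>)"
      using that by (intro mono H_add H_absdiff) auto
    also have "\<dots> \<le> E Y + E (\<lambda>\<omega>. \<bar>X \<omega> - Y \<omega>\<bar>)"
      using that by (intro subadd H_absdiff)
    finally show ?thesis .
  qed
  show ?thesis using *[OF assms] *[OF assms(2,1)] by (simp add: abs_minus_commute)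
qed

lemma cont_sets:
  assumes "X \<in> H" "\<And>i. B i \<in> sets M" "decseq B" "(\<Inter>i. B i) = {}"
    and "\<And>\<omega>. \<omega> \<in> \<Omega> \<Longrightarrow> 0 \<le> X \<omega>"
  shows "(\<lambda>i. E (\<lambda>\<omega>. indicator (B i) \<omega> * X \<omega>)) \<longlonglongrightarrow> 0"
proof (rule cont)
  show "(\<lambda>\<omega>. indicator (B i) \<omega> * X \<omega>) \<in> H" for i by (intro H_ind assms(1,2))
  fix \<omega> assume w: "\<omega> \<in> \<Omega>"
  show "decseq (\<lambda>i. indicator (B i) \<omega> * X \<omega>)"
    using assms(3) assms(5)[OF w] unfolding decseq_def
    by (auto intro!: mult_right_mono simp: indicator_def)
  obtain i where i: "\<omega> \<notin> B i" using assms(4) by blast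
  have "indicator (B j) \<omega> * X \<omega> = 0" if "j \<ge> i" for j
    using i assms(3) that unfolding decseq_def by (auto simp: indicator_def)
  then show "(\<lambda>i. indicator (B i) \<omega> * X \<omega>) \<longlonglongrightarrow> 0"
    by (intro tendsto_eventually) (auto simp: eventually_sequentially)
qed

lemma null_ind:
  assumes "X \<in> H" "N \<in> sets M" "E (indicator N) = 0" "\<And>\<omega>. \<omega> \<in> \<Omega> \<Longrightarrow> 0 \<le> X \<omega>"
  shows "E (\<lambda>\<omega>. indicator N \<omega> * X \<omega>) = 0"
proof -
  have [measurable]: "X \<in> borel_measurable M" using assms HD by auto
  define B where "B i = {\<omega> \<in> \<Omega>. X \<omega> > real i}" for i
  have B: "B i \<in> sets M" for i
  proof -
    have "{\<omega> \<in> space M. X \<omega> > real i} \<in> sets M" by measurable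
    then show ?thesis by (simp add: B_def)
  qed
  have B2: "(\<Inter>i. B i) = {}"
  proof (rule ccontr)
    assume "(\<Inter>i. B i) \<noteq> {}"
    then obtain \<omega> where w: "\<And>i. \<omega> \<in> B i" by blast
    obtain i where "X \<omega> < real i" using reals_Archimedean2 by blast
    then show False using w[of i] by (simp add: B_def)
  qed
  have lim: "(\<lambda>i. E (\<lambda>\<omega>. indicator (B i) \<omega> * X \<omega>)) \<longlonglongrightarrow> 0"
    using assms B B2 by (intro cont_sets) (auto simp: decseq_def B_def)
  have le: "E (\<lambda>\<omega>. indicator N \<omega> * X \<omega>) \<le> E (\<lambda>\<omega>. indicator (B i) \<omega> * X \<omega>)" for i
  proof -
    have "E (\<lambda>\<omega>. indicator N \<omega> * X \<omega>) \<le> E (\<lambda>\<omega>. real i * indicator N \<omega> + indicator (B i) \<omega> * X \<omega>)"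
      using assms B
      by (intro mono H_add H_ind H_scale indicator_H) (auto simp: indicator_def B_def)
    also have "\<dots> \<le> E (\<lambda>\<omega>. real i * indicator N \<omega>) + E (\<lambda>\<omega>. indicator (B i) \<omega> * X \<omega>)"
      using assms B by (intro subadd H_ind H_scale indicator_H)
    also have "E (\<lambda>\<omega>. real i * indicator N \<omega>) = 0"
      using assms scale[OF indicator_H, of N "real i"] by simp
    finally show ?thesis by simp
  qed
  have "E (\<lambda>\<omega>. indicator N \<omega> * X \<omega>) \<le> 0"
    by (rule LIMSEQ_le_const[OF lim]) (use le in blast)
  moreover have "0 \<le> E (\<lambda>\<omega>. indicator N \<omega> * X \<omega>)"
    using assms by (intro nonneg H_ind) auto
  ultimately show ?thesis by simp
qed

lemma null_Un:
  assumes "A \<in> sets M" "B \<in> sets M" "E (indicator A) = 0" "E (indicator B) = 0"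
  shows "E (indicator (A \<union> B)) = 0"
proof -
  have "E (indicator (A \<union> B)) \<le> E (\<lambda>\<omega>. indicator A \<omega> + indicator B \<omega>)"
    using assms by (intro mono H_add indicator_H) (auto simp: indicator_def)
  also have "\<dots> \<le> E (indicator A) + E (indicator B)"
    using assms by (intro subadd indicator_H)
  finally have "E (indicator (A \<union> B)) \<le> 0" using assms by simp
  moreover have "0 \<le> E (indicator (A \<union> B))"
    using assms by (intro nonneg indicator_H) auto
  ultimately show ?thesis by simp
qed

lemma cauchy_null_limit:
  assumes Z: "\<And>n. Z n \<in> H"
    and C: "\<And>e. e > 0 \<Longrightarrow> \<exists>k. \<forall>m\<ge>k. \<forall>n\<ge>k. E (\<lambda>\<omega>. \<bar>Z m \<omega> - Z n \<omega>\<bar>) < e"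
    and N: "N \<in> sets M" "E (indicator N) = 0"
    and lim: "\<And>\<omega>. \<omega> \<in> \<Omega> - N \<Longrightarrow> (\<lambda>n. Z n \<omega>) \<longlonglongrightarrow> 0"
  shows "(\<lambda>n. E (\<lambda>\<omega>. \<bar>Z n \<omega>\<bar>)) \<longlonglongrightarrow> 0"
proof (rule LIMSEQ_I)
  fix r :: real assume "r > 0"
  define e where "e = r / 4"
  have e: "e > 0" using \<open>r > 0\<close> by (simp add: e_def)
  obtain k where k: "\<And>m n. m \<ge> k \<Longrightarrow> n \<ge> k \<Longrightarrow> E (\<lambda>\<omega>. \<bar>Z m \<omega> - Z n \<omega>\<bar>) < e"
    using C[OF e] by blast
  have [measurable]: "Z n \<in> borel_measurable M" for n using Z HD by auto
  have [measurable]: "N \<in> sets M" by fact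
  define B where "B m = {\<omega> \<in> \<Omega>. \<exists>j\<in>{m..}. \<bar>Z j \<omega>\<bar> > e} - N" for m
  have B: "B m \<in> sets M" for m
  proof -
    have "{\<omega> \<in> space M. \<exists>j\<in>{m..}. \<bar>Z j \<omega>\<bar> > e} - N \<in> sets M" by measurable
    then show ?thesis by (simp only: B_def space_M)
  qed
  have B2: "(\<Inter>m. B m) = {}"
  proof (rule ccontr)
    assume "(\<Inter>m. B m) \<noteq> {}"
    then obtain \<omega> where w: "\<And>m. \<omega> \<in> B m" by blast
    have "\<omega> \<in> \<Omega> - N" using w[of 0] by (auto simp: B_def)
    then obtain m where "\<And>j. j \<ge> m \<Longrightarrow> \<bar>Z j \<omega>\<bar> < e"
      using LIMSEQ_D[OF lim e] by auto
    then show False using w[of m] by (force simp: B_def)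
  qed
  have "norm (E (\<lambda>\<omega>. \<bar>Z n \<omega>\<bar>) - 0) < r" if "n \<ge> k" for n
  proof -
    have "(\<lambda>m. E (\<lambda>\<omega>. indicator (B m) \<omega> * \<bar>Z n \<omega>\<bar>)) \<longlonglongrightarrow> 0"
      using B B2 Z by (intro cont_sets H_abs) (auto simp: decseq_def B_def intro: order_trans)
    then obtain m0 where m0: "\<And>m. m \<ge> m0 \<Longrightarrow> \<bar>E (\<lambda>\<omega>. indicator (B m) \<omega> * \<bar>Z n \<omega>\<bar>)\<bar> < e"
      using LIMSEQ_D[OF _ e] by fastforce
    define m where "m = max m0 k"
    have "E (\<lambda>\<omega>. \<bar>Z n \<omega>\<bar>) \<le> E (\<lambda>\<omega>. \<bar>Z n \<omega> - Z m \<omega>\<bar> + (e +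
        (indicator (B m) \<omega> * \<bar>Z n \<omega>\<bar> + indicator N \<omega> * \<bar>Z n \<omega>\<bar>)))"
    proof (intro mono H_add H_absdiff H_ind H_abs H_const Z B N)
      fix \<omega> assume w: "\<omega> \<in> \<Omega>"
      consider "\<omega> \<in> N" | "\<omega> \<in> B m" | "\<bar>Z m \<omega>\<bar> \<le> e"
        using w by (force simp: B_def not_less)
      then show "\<bar>Z n \<omega>\<bar> \<le> \<bar>Z n \<omega> - Z m \<omega>\<bar> + (e +
        (indicator (B m) \<omega> * \<bar>Z n \<omega>\<bar> + indicator N \<omega> * \<bar>Z n \<omega>\<bar>))"
        by cases (use e in \<open>auto simp: indicator_def\<close>)
    qed
    also have "\<dots> \<le> E (\<lambda>\<omega>. \<bar>Z n \<omega> - Z m \<omega>\<bar>) + E (\<lambda>\<omega>. e +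
        (indicator (B m) \<omega> * \<bar>Z n \<omega>\<bar> + indicator N \<omega> * \<bar>Z n \<omega>\<bar>))"
      by (intro subadd H_add H_absdiff H_ind H_abs H_const Z B N)
    also have "E (\<lambda>\<omega>. e + (indicator (B m) \<omega> * \<bar>Z n \<omega>\<bar> + indicator N \<omega> * \<bar>Z n \<omega>\<bar>))
       \<le> E (\<lambda>_. e) + E (\<lambda>\<omega>. indicator (B m) \<omega> * \<bar>Z n \<omega>\<bar> + indicator N \<omega> * \<bar>Z n \<omega>\<bar>)"
      by (intro subadd H_add H_absdiff H_ind H_abs H_const Z B N)
    also have "E (\<lambda>\<omega>. indicator (B m) \<omega> * \<bar>Z n \<omega>\<bar> + indicator N \<omega> * \<bar>Z n \<omega>\<bar>)
       \<le> E (\<lambda>\<omega>. indicator (B m) \<omega> * \<bar>Z n \<omega>\<bar>) + E (\<lambda>\<omega>. indicator N \<omega> * \<bar>Z n \<omega>\<bar>)"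
      by (intro subadd H_add H_absdiff H_ind H_abs H_const Z B N)
    finally have "E (\<lambda>\<omega>. \<bar>Z n \<omega>\<bar>) \<le> E (\<lambda>\<omega>. \<bar>Z n \<omega> - Z m \<omega>\<bar>) + (E (\<lambda>_. e)
       + (E (\<lambda>\<omega>. indicator (B m) \<omega> * \<bar>Z n \<omega>\<bar>) + E (\<lambda>\<omega>. indicator N \<omega> * \<bar>Z n \<omega>\<bar>)))" by simp
    moreover have "E (\<lambda>\<omega>. indicator N \<omega> * \<bar>Z n \<omega>\<bar>) = 0"
      using null_ind[OF H_abs[OF Z] N] by simp
    moreover have "E (\<lambda>\<omega>. \<bar>Z n \<omega> - Z m \<omega>\<bar>) < e" using k[of n m] that by (simp add: m_def)
    moreover have "E (\<lambda>\<omega>. indicator (B m) \<omega> * \<bar>Z n \<omega>\<bar>) < e" using m0[of m] by (simp add: m_def)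
    moreover have "0 \<le> E (\<lambda>\<omega>. \<bar>Z n \<omega>\<bar>)" by (intro nonneg H_abs Z) simp
    ultimately show ?thesis using e by (simp add: const e_def)
  qed
  then show "\<exists>no. \<forall>n\<ge>no. norm (E (\<lambda>\<omega>. \<bar>Z n \<omega>\<bar>) - 0) < r" by blast
qed

lemma representsD:
  assumes "represents Xs X"
  shows "Xs n \<in> H" "e > 0 \<Longrightarrow> \<exists>k. \<forall>m\<ge>k. \<forall>n\<ge>k. E (\<lambda>\<omega>. \<bar>Xs m \<omega> - Xs n \<omega>\<bar>) < e"
    "\<exists>N\<in>sets M. E (indicator N) = 0 \<and> (\<forall>\<omega>\<in>\<Omega> - N. (\<lambda>n. ereal (Xs n \<omega>)) \<longlonglongrightarrow> X \<omega>)"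
  using assms unfolding represents_def by auto

lemma represents_finite:
  assumes R: "represents Xs X"
  shows "\<exists>N\<in>sets M. E (indicator N) = 0 \<and>
    (\<forall>\<omega>\<in>\<Omega> - N. \<bar>X \<omega>\<bar> \<noteq> \<infinity> \<and> (\<lambda>n. ereal (Xs n \<omega>)) \<longlonglongrightarrow> X \<omega>)"
proof -
  note Xs = representsD(1)[OF R]
  obtain N where N: "N \<in> sets M" "E (indicator N) = 0"
    and lim: "\<And>\<omega>. \<omega> \<in> \<Omega> - N \<Longrightarrow> (\<lambda>n. ereal (Xs n \<omega>)) \<longlonglongrightarrow> X \<omega>"
    using representsD(3)[OF R] by blast
  have [measurable]: "Xs n \<in> borel_measurable M" for n using Xs HD by auto
  have [measurable]: "N \<in> sets M" by fact
  define A where "A = {\<omega> \<in> \<Omega>. \<forall>c::nat. \<exists>m. \<forall>n\<in>{m..}. real c \<le> \<bar>Xs n \<omega>\<bar>}"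
  have A[measurable]: "A \<in> sets M"
  proof -
    have "{\<omega> \<in> space M. \<forall>c::nat. \<exists>m. \<forall>n\<in>{m..}. real c \<le> \<bar>Xs n \<omega>\<bar>} \<in> sets M" by measurable
    then show ?thesis by (simp add: A_def)
  qed
  obtain k where k: "\<And>m n. m \<ge> k \<Longrightarrow> n \<ge> k \<Longrightarrow> E (\<lambda>\<omega>. \<bar>Xs m \<omega> - Xs n \<omega>\<bar>) < 1"
    using representsD(2)[OF R, of 1] by force
  define C where "C = 1 + E (\<lambda>\<omega>. \<bar>Xs k \<omega>\<bar>)"
  have C: "E (\<lambda>\<omega>. \<bar>Xs m \<omega>\<bar>) \<le> C" if "m \<ge> k" for m
  proof -
    have "E (\<lambda>\<omega>. \<bar>Xs m \<omega>\<bar>) \<le> E (\<lambda>\<omega>. \<bar>Xs m \<omega> - Xs k \<omega>\<bar> + \<bar>Xs k \<omega>\<bar>)"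
      by (intro mono H_add H_absdiff H_abs Xs) auto
    also have "\<dots> \<le> E (\<lambda>\<omega>. \<bar>Xs m \<omega> - Xs k \<omega>\<bar>) + E (\<lambda>\<omega>. \<bar>Xs k \<omega>\<bar>)"
      by (intro subadd H_absdiff H_abs Xs)
    also have "\<dots> \<le> C" using k[OF that, of k] by (simp add: C_def)
    finally show ?thesis .
  qed
  have bnd: "real (Suc c) * E (indicator A) \<le> C" for c
  proof -
    define B where "B m = {\<omega> \<in> A. \<exists>n\<in>{m..}. \<bar>Xs n \<omega>\<bar> < real (Suc c)}" for m
    have B[measurable]: "B m \<in> sets M" for m
    proof -
      have "A \<inter> {\<omega> \<in> space M. \<exists>n\<in>{m..}. \<bar>Xs n \<omega>\<bar> < real (Suc c)} \<in> sets M" by measurable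
      moreover have "A \<inter> {\<omega> \<in> space M. \<exists>n\<in>{m..}. \<bar>Xs n \<omega>\<bar> < real (Suc c)} = B m"
        by (auto simp: A_def B_def)
      ultimately show ?thesis by simp
    qed
    have B2: "(\<Inter>m. B m) = {}"
    proof (rule ccontr)
      assume "(\<Inter>m. B m) \<noteq> {}"
      then obtain \<omega> where w: "\<And>m. \<omega> \<in> B m" by blast
      then have "\<omega> \<in> A" by (auto simp: B_def)
      then obtain m where "\<And>n. n \<ge> m \<Longrightarrow> real (Suc c) \<le> \<bar>Xs n \<omega>\<bar>" unfolding A_def by blast
      then show False using w[of m] by (force simp: B_def)
    qed
    have l: "(\<lambda>m. E (\<lambda>\<omega>. indicator (B m) \<omega> * real (Suc c))) \<longlonglongrightarrow> 0"
      using B B2 by (intro cont_sets H_const) (auto simp: decseq_def B_def intro: order_trans)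
    have "real (Suc c) * E (indicator A) \<le> C + E (\<lambda>\<omega>. indicator (B m) \<omega> * real (Suc c))"
      if "m \<ge> k" for m
    proof -
      have "real (Suc c) * E (indicator A) = E (\<lambda>\<omega>. real (Suc c) * indicator A \<omega>)"
        by (intro scale[symmetric] indicator_H A) simp
      also have "\<dots> \<le> E (\<lambda>\<omega>. \<bar>Xs m \<omega>\<bar> + indicator (B m) \<omega> * real (Suc c))"
        by (intro mono H_add H_abs H_ind H_const H_scale indicator_H A B Xs)
          (auto simp: indicator_def B_def not_less)
      also have "\<dots> \<le> E (\<lambda>\<omega>. \<bar>Xs m \<omega>\<bar>) + E (\<lambda>\<omega>. indicator (B m) \<omega> * real (Suc c))"
        by (intro subadd H_abs H_ind H_const B Xs)
      finally show ?thesis using C[OF that] by simp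
    qed
    moreover have "(\<lambda>m. C + E (\<lambda>\<omega>. indicator (B m) \<omega> * real (Suc c))) \<longlonglongrightarrow> C + 0"
      by (intro tendsto_intros l)
    ultimately show ?thesis using LIMSEQ_le_const by fastforce
  qed
  have "E (indicator A) = 0"
  proof (rule ccontr)
    assume "E (indicator A) \<noteq> 0"
    moreover have "0 \<le> E (indicator A)" by (intro nonneg indicator_H A) simp
    ultimately have p: "E (indicator A) > 0" by simp
    obtain n :: nat where "C / E (indicator A) < real n" using reals_Archimedean2 by blast
    then have "C < real (Suc n) * E (indicator A)" using p by (simp add: field_simps)
    then show False using bnd[of n] by simp
  qed
  then have N': "E (indicator (N \<union> A)) = 0" using null_Un N A by blast
  have "\<bar>X \<omega>\<bar> \<noteq> \<infinity>" if w: "\<omega> \<in> \<Omega> - (N \<union> A)" for \<omega>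
  proof
    assume inf: "\<bar>X \<omega>\<bar> = \<infinity>"
    have "(\<lambda>n. \<bar>ereal (Xs n \<omega>)\<bar>) \<longlonglongrightarrow> \<bar>X \<omega>\<bar>"
      using lim[of \<omega>] w by (intro tendsto_abs_ereal) auto
    then have "(\<lambda>n. ereal \<bar>Xs n \<omega>\<bar>) \<longlonglongrightarrow> \<infinity>" using inf by simp
    then have c: "\<exists>m. \<forall>n\<ge>m. c \<le> \<bar>Xs n \<omega>\<bar>" for c by (simp add: Lim_PInfty)
    have "\<exists>m. \<forall>n\<in>{m..}. real k \<le> \<bar>Xs n \<omega>\<bar>" for k
      using c[of "real k"] unfolding Ball_def atLeast_iff .
    then have "\<omega> \<in> A" using w unfolding A_def by blast
    then show False using w by blast
  qed
  then show ?thesis using N' lim A N(1) by (intro bexI[of _ "N \<union> A"]) auto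
qed

lemma represents_unique:
  assumes R: "represents Xs X" "represents Ys X"
  shows "(\<lambda>n. E (\<lambda>\<omega>. \<bar>Xs n \<omega> - Ys n \<omega>\<bar>)) \<longlonglongrightarrow> 0"
proof -
  note Xs = representsD(1)[OF R(1)] and Ys = representsD(1)[OF R(2)]
  obtain N where N: "N \<in> sets M" "E (indicator N) = 0"
    and lim: "\<forall>\<omega>\<in>\<Omega> - N. \<bar>X \<omega>\<bar> \<noteq> \<infinity> \<and> (\<lambda>n. ereal (Xs n \<omega>)) \<longlonglongrightarrow> X \<omega>"
    using represents_finite[OF R(1)] by (elim bexE conjE)
  obtain N' where N': "N' \<in> sets M" "E (indicator N') = 0"
    and lim': "\<And>\<omega>. \<omega> \<in> \<Omega> - N' \<Longrightarrow> (\<lambda>n. ereal (Ys n \<omega>)) \<longlonglongrightarrow> X \<omega>"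
    using representsD(3)[OF R(2)] by blast
  show ?thesis
  proof (rule cauchy_null_limit[where N = "N \<union> N'"])
    show "(\<lambda>\<omega>. Xs n \<omega> - Ys n \<omega>) \<in> H" for n by (intro H_diff Xs Ys)
    show "N \<union> N' \<in> sets M" using N N' by blast
    show "E (indicator (N \<union> N')) = 0" using N N' null_Un by blast
    fix \<omega> assume w: "\<omega> \<in> \<Omega> - (N \<union> N')"
    then have "\<bar>X \<omega>\<bar> \<noteq> \<infinity>" and limX: "(\<lambda>n. ereal (Xs n \<omega>)) \<longlonglongrightarrow> X \<omega>" using lim by simp_all
    then obtain x where x: "X \<omega> = ereal x" by (cases "X \<omega>") auto
    have "(\<lambda>n. Xs n \<omega>) \<longlonglongrightarrow> x" "(\<lambda>n. Ys n \<omega>) \<longlonglongrightarrow> x"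
      using limX lim'[of \<omega>] w x by auto
    then show "(\<lambda>n. Xs n \<omega> - Ys n \<omega>) \<longlonglongrightarrow> 0" using tendsto_diff by fastforce
  next
    fix e :: real assume "e > 0"
    then have e: "e / 2 > 0" by simp
    obtain k where k: "\<And>m n. m \<ge> k \<Longrightarrow> n \<ge> k \<Longrightarrow> E (\<lambda>\<omega>. \<bar>Xs m \<omega> - Xs n \<omega>\<bar>) < e / 2"
      using representsD(2)[OF R(1) e] by blast
    obtain k' where k': "\<And>m n. m \<ge> k' \<Longrightarrow> n \<ge> k' \<Longrightarrow> E (\<lambda>\<omega>. \<bar>Ys m \<omega> - Ys n \<omega>\<bar>) < e / 2"
      using representsD(2)[OF R(2) e] by blast
    have "E (\<lambda>\<omega>. \<bar>Xs m \<omega> - Ys m \<omega> - (Xs n \<omega> - Ys n \<omega>)\<bar>) < e"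
      if "m \<ge> max k k'" "n \<ge> max k k'" for m n
    proof -
      have "E (\<lambda>\<omega>. \<bar>Xs m \<omega> - Ys m \<omega> - (Xs n \<omega> - Ys n \<omega>)\<bar>)
          \<le> E (\<lambda>\<omega>. \<bar>Xs m \<omega> - Xs n \<omega>\<bar> + \<bar>Ys m \<omega> - Ys n \<omega>\<bar>)"
        by (intro mono H_add H_abs H_diff Xs Ys) auto
      also have "\<dots> \<le> E (\<lambda>\<omega>. \<bar>Xs m \<omega> - Xs n \<omega>\<bar>) + E (\<lambda>\<omega>. \<bar>Ys m \<omega> - Ys n \<omega>\<bar>)"
        by (intro subadd H_abs H_diff Xs Ys)
      also have "\<dots> < e" using k[of m n] k'[of m n] that by simp
      finally show ?thesis .
    qed
    then show "\<exists>k. \<forall>m\<ge>k. \<forall>n\<ge>k. E (\<lambda>\<omega>. \<bar>Xs m \<omega> - Ys m \<omega> - (Xs n \<omega> - Ys n \<omega>)\<bar>) < e" by blast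
  qed
qed

lemma represents_limit:
  assumes R: "represents Xs X"
  shows "(\<lambda>n. E (Xs n)) \<longlonglongrightarrow> E1 X"
proof -
  note Xs = representsD(1)[OF R]
  have "Cauchy (\<lambda>n. E (Xs n))"
  proof (rule CauchyI)
    fix e :: real assume "e > 0"
    then obtain k where k: "\<And>m n. m \<ge> k \<Longrightarrow> n \<ge> k \<Longrightarrow> E (\<lambda>\<omega>. \<bar>Xs m \<omega> - Xs n \<omega>\<bar>) < e"
      using representsD(2)[OF R] by blast
    have "norm (E (Xs m) - E (Xs n)) < e" if "m \<ge> k" "n \<ge> k" for m n
      using k[OF that] lipschitz[OF Xs Xs, of m n] by simp
    then show "\<exists>k. \<forall>m\<ge>k. \<forall>n\<ge>k. norm (E (Xs m) - E (Xs n)) < e" by blast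
  qed
  then obtain l where l: "(\<lambda>n. E (Xs n)) \<longlonglongrightarrow> l" using Cauchy_convergent convergent_def by blast
  have "l' = l" if R': "represents Ys X" and l': "(\<lambda>n. E (Ys n)) \<longlonglongrightarrow> l'" for l' Ys
  proof -
    have "(\<lambda>n. E (Xs n) - E (Ys n)) \<longlonglongrightarrow> 0"
      by (rule Lim_null_comparison[OF _ represents_unique[OF R R']])
        (use lipschitz[OF Xs representsD(1)[OF R']] in auto)
    moreover have "(\<lambda>n. E (Xs n) - E (Ys n)) \<longlonglongrightarrow> l - l'" by (intro tendsto_diff l l')
    ultimately show ?thesis using LIMSEQ_unique by fastforce
  qed
  then have "E1 X = l" unfolding E1_def
    by (intro the_equality exI[of _ Xs] conjI R l) blast
  then show ?thesis using l by simp
qed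

lemma H_represents:
  assumes "X \<in> H"
  shows "represents (\<lambda>_. X) (\<lambda>\<omega>. ereal (X \<omega>))"
proof -
  have "E (indicator {}) = 0" using const[of 0] by (simp add: indicator_def[abs_def])
  then show ?thesis unfolding represents_def using assms const[of 0]
    by (auto intro!: bexI[of _ "{}"])
qed

lemma H_subset_L1: "X \<in> H \<Longrightarrow> (\<lambda>\<omega>. ereal (X \<omega>)) \<in> L1"
  using H_represents HD unfolding L1_def by auto

lemma E1_eq_E: "X \<in> H \<Longrightarrow> E1 (\<lambda>\<omega>. ereal (X \<omega>)) = E X"
  using represents_limit[OF H_represents] LIMSEQ_unique tendsto_const by blast

lemma represents_indicator_abs:
  assumes R: "represents Xs X" and A: "A \<in> sets M"
  shows "represents (\<lambda>n \<omega>. indicator A \<omega> * \<bar>Xs n \<omega>\<bar>) (\<lambda>\<omega>. indicator A \<omega> * \<bar>X \<omega>\<bar>)"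
  unfolding represents_def
proof (intro conjI allI impI)
  note Xs = representsD(1)[OF R]
  show "(\<lambda>\<omega>. indicator A \<omega> * \<bar>Xs n \<omega>\<bar>) \<in> H" for n by (intro H_ind H_abs Xs A)
  fix e :: real assume "e > 0"
  then obtain k where k: "\<And>m n. m \<ge> k \<Longrightarrow> n \<ge> k \<Longrightarrow> E (\<lambda>\<omega>. \<bar>Xs m \<omega> - Xs n \<omega>\<bar>) < e"
    using representsD(2)[OF R] by blast
  have "E (\<lambda>\<omega>. \<bar>indicator A \<omega> * \<bar>Xs m \<omega>\<bar> - indicator A \<omega> * \<bar>Xs n \<omega>\<bar>\<bar>)
      \<le> E (\<lambda>\<omega>. \<bar>Xs m \<omega> - Xs n \<omega>\<bar>)" for m n
    by (intro mono H_absdiff H_ind H_abs Xs A) (auto simp: indicator_def)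
  then show "\<exists>k. \<forall>m\<ge>k. \<forall>n\<ge>k.
      E (\<lambda>\<omega>. \<bar>indicator A \<omega> * \<bar>Xs m \<omega>\<bar> - indicator A \<omega> * \<bar>Xs n \<omega>\<bar>\<bar>) < e"
    using k order_le_less_trans by blast
next
  obtain N where N: "N \<in> sets M" "E (indicator N) = 0"
    and lim: "\<forall>\<omega>\<in>\<Omega> - N. (\<lambda>n. ereal (Xs n \<omega>)) \<longlonglongrightarrow> X \<omega>"
    using representsD(3)[OF R] by (elim bexE conjE)
  have "(\<lambda>n. ereal (indicator A \<omega> * \<bar>Xs n \<omega>\<bar>)) \<longlonglongrightarrow> indicator A \<omega> * \<bar>X \<omega>\<bar>"
    if w: "\<omega> \<in> \<Omega> - N" for \<omega>
  proof (cases "\<omega> \<in> A")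
    case True
    have "(\<lambda>n. \<bar>ereal (Xs n \<omega>)\<bar>) \<longlonglongrightarrow> \<bar>X \<omega>\<bar>"
      using lim w by (intro tendsto_abs_ereal) blast
    then show ?thesis using True by simp
  qed (simp flip: zero_ereal_def)
  then show "\<exists>N\<in>sets M. E (indicator N) = 0 \<and>
      (\<forall>\<omega>\<in>\<Omega> - N. (\<lambda>n. ereal (indicator A \<omega> * \<bar>Xs n \<omega>\<bar>)) \<longlonglongrightarrow> indicator A \<omega> * \<bar>X \<omega>\<bar>)"
    using N by blast
qed

lemma L1_indicator_abs:
  assumes "X \<in> L1" "A \<in> sets M"
  shows "(\<lambda>\<omega>. indicator A \<omega> * \<bar>X \<omega>\<bar>) \<in> L1"
proof -
  have [measurable]: "X \<in> borel_measurable M" "A \<in> sets M" using assms by (auto simp: L1_def)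
  have "(\<lambda>\<omega>. indicator A \<omega> * \<bar>X \<omega>\<bar>) \<in> borel_measurable M" by measurable
  then show ?thesis using assms represents_indicator_abs unfolding L1_def by blast
qed

lemma L1_abs:
  assumes "X \<in> L1"
  shows "(\<lambda>\<omega>. \<bar>X \<omega>\<bar>) \<in> L1"
proof -
  obtain Xs where R: "represents Xs X" using assms unfolding L1_def by blast
  have "represents (\<lambda>n \<omega>. indicator \<Omega> \<omega> * \<bar>Xs n \<omega>\<bar>) (\<lambda>\<omega>. \<bar>X \<omega>\<bar>)"
    using represents_indicator_abs[OF R, of \<Omega>] sets.top[of M] unfolding represents_def by simp
  moreover have "(\<lambda>\<omega>. \<bar>X \<omega>\<bar>) \<in> borel_measurable M" using assms by (auto simp: L1_def)
  ultimately show ?thesis unfolding L1_def by blast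
qed

(* Every Cauchy sequence in H determines an element of L1. *)
lemma Cauchy_represents:
  fixes Xs :: "nat \<Rightarrow> 'a \<Rightarrow> real"
  assumes Xs: "\<And>n. Xs n \<in> H"
    and C: "\<And>e. e > 0 \<Longrightarrow> \<exists>k. \<forall>m\<ge>k. \<forall>n\<ge>k. E (\<lambda>\<omega>. \<bar>Xs m \<omega> - Xs n \<omega>\<bar>) < e"
  shows "\<exists>X\<in>L1. \<exists>r. strict_mono r \<and> represents (\<lambda>n. Xs (r n)) X"
proof -
  have "\<exists>k. \<forall>m\<ge>k. \<forall>n\<ge>k. E (\<lambda>\<omega>. \<bar>Xs m \<omega> - Xs n \<omega>\<bar>) < (1/4) ^ i" for i :: nat
    by (rule C) simp
  then obtain k :: "nat \<Rightarrow> nat" where k: "\<And>i m n. m \<ge> k i \<Longrightarrow> n \<ge> k i \<Longrightarrow>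
      E (\<lambda>\<omega>. \<bar>Xs m \<omega> - Xs n \<omega>\<bar>) < (1/4) ^ i" by metis
  define r where "r n = n + (\<Sum>i\<le>n. k i)" for n
  have r: "strict_mono r" unfolding strict_mono_Suc_iff by (simp add: r_def)
  have rk: "r n \<ge> k n" for n by (simp add: r_def member_le_sum trans_le_add2)
  define Y where "Y n = Xs (r n)" for n
  have Y: "Y n \<in> H" for n by (simp add: Y_def Xs)
  have [measurable]: "Y n \<in> borel_measurable M" for n using Y HD by auto
  have YE: "E (\<lambda>\<omega>. \<bar>Y (Suc n) \<omega> - Y n \<omega>\<bar>) < (1/4) ^ n" for n
    unfolding Y_def
    using k[where i = n, of "r (Suc n)" "r n"] rk[of n] strict_monoD[OF r, of n "Suc n"] by simp
  define B where "B n = {\<omega> \<in> \<Omega>. \<bar>Y (Suc n) \<omega> - Y n \<omega>\<bar> > (1/2) ^ n}" for n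
  have B: "B n \<in> sets M" for n
  proof -
    have "{\<omega> \<in> space M. \<bar>Y (Suc n) \<omega> - Y n \<omega>\<bar> > (1/2) ^ n} \<in> sets M" by measurable
    then show ?thesis by (simp only: B_def space_M)
  qed
  have EB: "E (indicator (B n)) \<le> (1/2) ^ n" for n
  proof -
    have "E (indicator (B n)) \<le> E (\<lambda>\<omega>. 2 ^ n * \<bar>Y (Suc n) \<omega> - Y n \<omega>\<bar>)"
    proof (intro mono indicator_H B H_scale H_absdiff Y)
      fix \<omega>
      show "indicator (B n) \<omega> \<le> 2 ^ n * \<bar>Y (Suc n) \<omega> - Y n \<omega>\<bar>"
        by (cases "\<omega> \<in> B n") (auto simp: B_def power_one_over divide_simps mult.commute)
    qed
    also have "\<dots> = 2 ^ n * E (\<lambda>\<omega>. \<bar>Y (Suc n) \<omega> - Y n \<omega>\<bar>)"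
      by (intro scale H_absdiff Y) simp
    also have "\<dots> \<le> 2 ^ n * (1/4) ^ n" using YE[of n] by (intro mult_left_mono) auto
    also have "\<dots> = (1/2) ^ n" by (simp add: power_mult_distrib[symmetric])
    finally show ?thesis .
  qed
  define U where "U n m = (\<Union>j\<in>{n..<n+m}. B j)" for n m
  have U: "U n m \<in> sets M" for n m using B unfolding U_def by auto
  have EU: "E (indicator (U n m)) \<le> 2 * (1/2) ^ n - 2 * (1/2) ^ (n + m)" for n m
  proof (induction m)
    case 0
    then show ?case using const[of 0] by (simp add: U_def indicator_def[abs_def])
  next
    case (Suc m)
    have "E (indicator (U n (Suc m))) \<le> E (\<lambda>\<omega>. indicator (U n m) \<omega> + indicator (B (n + m)) \<omega>)"
      by (intro mono H_add indicator_H U B) (auto simp: indicator_def U_def less_Suc_eq)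
    also have "\<dots> \<le> E (indicator (U n m)) + E (indicator (B (n + m)))"
      by (intro subadd indicator_H U B)
    also have "\<dots> \<le> 2 * (1/2) ^ n - 2 * (1/2) ^ (n + Suc m)"
      using Suc EB[of "n + m"] by simp
    finally show ?case .
  qed
  define N where "N = (\<Inter>n. \<Union>j\<in>{n..}. B j)"
  have N: "N \<in> sets M" using B unfolding N_def by auto
  have EN: "E (indicator N) \<le> 2 * (1/2) ^ n" for n
  proof -
    have "(\<lambda>m. E (\<lambda>\<omega>. indicator (N - U n m) \<omega> * 1)) \<longlonglongrightarrow> 0"
    proof (intro cont_sets H_const sets.Diff N U)
      show "decseq (\<lambda>m. N - U n m)" unfolding decseq_def U_def by fastforce
      show "(\<Inter>m. N - U n m) = {}"
      proof (rule ccontr)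
        assume "(\<Inter>m. N - U n m) \<noteq> {}"
        then obtain \<omega> where w: "\<And>m. \<omega> \<in> N - U n m" by blast
        then have "\<omega> \<in> N" by blast
        then obtain j where j: "j \<ge> n" "\<omega> \<in> B j" unfolding N_def by auto
        then have "\<omega> \<in> U n (Suc (j - n))" unfolding U_def by auto
        then show False using w by blast
      qed
    qed simp
    then have l: "(\<lambda>m. 2 * (1/2) ^ n + E (\<lambda>\<omega>. indicator (N - U n m) \<omega> * 1)) \<longlonglongrightarrow> 2 * (1/2) ^ n + 0"
      by (intro tendsto_add tendsto_const)
    have "E (indicator N) \<le> 2 * (1/2) ^ n + E (\<lambda>\<omega>. indicator (N - U n m) \<omega> * 1)" for m
    proof -
      have "E (indicator N) \<le> E (\<lambda>\<omega>. indicator (U n m) \<omega> + indicator (N - U n m) \<omega> * 1)"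
        by (intro mono H_add H_ind indicator_H H_const sets.Diff N U) (auto simp: indicator_def)
      also have "\<dots> \<le> E (indicator (U n m)) + E (\<lambda>\<omega>. indicator (N - U n m) \<omega> * 1)"
        by (intro subadd H_ind indicator_H H_const sets.Diff N U)
      also have "E (indicator (U n m)) \<le> 2 * (1/2) ^ n"
        using EU[of n m] by (smt (verit) zero_le_power divide_nonneg_nonneg)
      finally show ?thesis by simp
    qed
    then show ?thesis using LIMSEQ_le_const[OF l] by simp
  qed
  have "(\<lambda>n. 2 * (1/2) ^ n :: real) \<longlonglongrightarrow> 2 * 0"
    by (intro tendsto_mult tendsto_const LIMSEQ_power_zero) simp
  then have "E (indicator N) \<le> 2 * 0" by (rule LIMSEQ_le_const) (use EN in blast)
  moreover have "0 \<le> E (indicator N)" by (intro nonneg indicator_H N) simp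
  ultimately have N0: "E (indicator N) = 0" by simp
  have conv: "convergent (\<lambda>n. Y n \<omega>)" if w: "\<omega> \<in> \<Omega> - N" for \<omega>
  proof -
    obtain n where "\<And>j. j \<ge> n \<Longrightarrow> \<omega> \<notin> B j" using w unfolding N_def by auto
    then have "norm (Y (Suc j) \<omega> - Y j \<omega>) \<le> (1/2) ^ j" if "j \<ge> n" for j
      using that w by (force simp: B_def not_less)
    then have "summable (\<lambda>j. Y (Suc j) \<omega> - Y j \<omega>)"
      by (intro summable_comparison_test[OF _ summable_geometric[of "1/2::real"]]) auto
    then have "convergent (\<lambda>m. \<Sum>j<m. Y (Suc j) \<omega> - Y j \<omega>)" by (simp add: summable_iff_convergent)
    then have "convergent (\<lambda>m. Y m \<omega> - Y 0 \<omega>)"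
      by (simp only: sum_lessThan_telescope[of "\<lambda>n. Y n \<omega>"])
    then obtain l where "(\<lambda>m. Y m \<omega> - Y 0 \<omega>) \<longlonglongrightarrow> l" unfolding convergent_def by blast
    then have "(\<lambda>m. (Y m \<omega> - Y 0 \<omega>) + Y 0 \<omega>) \<longlonglongrightarrow> l + Y 0 \<omega>" by (intro tendsto_intros)
    then show ?thesis unfolding convergent_def by auto
  qed
  define X where "X \<omega> = limsup (\<lambda>n. ereal (Y n \<omega>))" for \<omega>
  have "X \<in> borel_measurable M" unfolding X_def[abs_def] by measurable
  moreover have "represents Y X"
    unfolding represents_def
  proof (intro conjI allI impI)
    fix e :: real assume "e > 0"
    then obtain k where k: "\<And>m n. m \<ge> k \<Longrightarrow> n \<ge> k \<Longrightarrow> E (\<lambda>\<omega>. \<bar>Xs m \<omega> - Xs n \<omega>\<bar>) < e"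
      using C by blast
    have "E (\<lambda>\<omega>. \<bar>Y m \<omega> - Y n \<omega>\<bar>) < e" if "m \<ge> k" "n \<ge> k" for m n
      unfolding Y_def using that seq_suble[OF r, of m] seq_suble[OF r, of n] by (intro k) auto
    then show "\<exists>k. \<forall>m\<ge>k. \<forall>n\<ge>k. E (\<lambda>\<omega>. \<bar>Y m \<omega> - Y n \<omega>\<bar>) < e" by blast
  next
    have "(\<lambda>n. ereal (Y n \<omega>)) \<longlonglongrightarrow> X \<omega>" if w: "\<omega> \<in> \<Omega> - N" for \<omega>
    proof -
      obtain l where "(\<lambda>n. Y n \<omega>) \<longlonglongrightarrow> l" using conv[OF w] unfolding convergent_def by blast
      then have l: "(\<lambda>n. ereal (Y n \<omega>)) \<longlonglongrightarrow> ereal l" by simp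
      then have "X \<omega> = ereal l" unfolding X_def by (intro lim_imp_Limsup) simp_all
      then show ?thesis using l by simp
    qed
    then show "\<exists>N\<in>sets M. E (indicator N) = 0 \<and> (\<forall>\<omega>\<in>\<Omega> - N. (\<lambda>n. ereal (Y n \<omega>)) \<longlonglongrightarrow> X \<omega>)"
      using N N0 by blast
  qed (rule Y)
  ultimately have "X \<in> L1" "represents (\<lambda>n. Xs (r n)) X"
    unfolding L1_def Y_def[abs_def] by blast+
  then show ?thesis using r by blast
qed

end

end

theory Submission
  imports Defs
begin

text \<open>Both directions rest on \<open>I\<^sub>A |X| \<le> c I\<^sub>A + I_{|X| \<ge> c} |X|\<close> (for necessity, with \<open>A = \<Omega>\<close> giving
  boundedness) and on Markov's inequality \<open>c I_{|X| \<ge> c} \<le> |X|\<close> (for sufficiency).  Only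
  monotonicity and subadditivity of the extended expectation are needed; both are transported
  from \<open>H\<close> to its completion along approximating sequences.\<close>

context SL_expectation
begin

section \<open>Order and addition in the completion\<close>

text \<open>Gives the Cauchy property of any sequence obtained from two representing ones by an
  operation that is 1-Lipschitz in each argument. It serves twice: for the positive part of a
  difference and for a sum.\<close>

lemma Cauchy_dominated:
  assumes X: "represents Xs X" and Y: "represents Ys Y"
    and Z: "\<And>n. Z n \<in> H"
    and le: "\<And>m n \<omega>. \<omega> \<in> \<Omega> \<Longrightarrow>
      \<bar>Z m \<omega> - Z n \<omega>\<bar> \<le> \<bar>Xs m \<omega> - Xs n \<omega>\<bar> + \<bar>Ys m \<omega> - Ys n \<omega>\<bar>"
    and e: "e > 0"
  shows "\<exists>k. \<forall>m\<ge>k. \<forall>n\<ge>k. E (\<lambda>\<omega>. \<bar>Z m \<omega> - Z n \<omega>\<bar>) < e"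
proof -
  note Xs = representsD(1)[OF X] and Ys = representsD(1)[OF Y]
  have e2: "e / 2 > 0" using e by simp
  obtain k where k: "\<And>m n. m \<ge> k \<Longrightarrow> n \<ge> k \<Longrightarrow> E (\<lambda>\<omega>. \<bar>Xs m \<omega> - Xs n \<omega>\<bar>) < e / 2"
    using representsD(2)[OF X e2] by blast
  obtain k' where k': "\<And>m n. m \<ge> k' \<Longrightarrow> n \<ge> k' \<Longrightarrow> E (\<lambda>\<omega>. \<bar>Ys m \<omega> - Ys n \<omega>\<bar>) < e / 2"
    using representsD(2)[OF Y e2] by blast
  have "E (\<lambda>\<omega>. \<bar>Z m \<omega> - Z n \<omega>\<bar>) < e" if "m \<ge> max k k'" "n \<ge> max k k'" for m n
  proof -
    have "E (\<lambda>\<omega>. \<bar>Z m \<omega> - Z n \<omega>\<bar>) \<le> E (\<lambda>\<omega>. \<bar>Xs m \<omega> - Xs n \<omega>\<bar> + \<bar>Ys m \<omega> - Ys n \<omega>\<bar>)"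
      by (intro mono H_add H_absdiff Xs Ys Z le)
    also have "\<dots> \<le> E (\<lambda>\<omega>. \<bar>Xs m \<omega> - Xs n \<omega>\<bar>) + E (\<lambda>\<omega>. \<bar>Ys m \<omega> - Ys n \<omega>\<bar>)"
      by (intro subadd H_absdiff Xs Ys)
    also have "\<dots> < e" using k[of m n] k'[of m n] that by simp
    finally show ?thesis .
  qed
  then show ?thesis by blast
qed

text \<open>Reduces limit arguments about two extended-real elements to real-valued limits
  \<open>x\<close> and \<open>y\<close>: each element is finite off some null set, and the union of
  two null sets is null.\<close>

lemma represents_common_null:
  assumes "represents Xs X" "represents Ys Y"
  obtains N x y where "N \<in> sets M" "E (indicator N) = 0"
    "\<And>\<omega>. \<omega> \<in> \<Omega> - N \<Longrightarrow> X \<omega> = ereal (x \<omega>)" "\<And>\<omega>. \<omega> \<in> \<Omega> - N \<Longrightarrow> Y \<omega> = ereal (y \<omega>)"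
    "\<And>\<omega>. \<omega> \<in> \<Omega> - N \<Longrightarrow> (\<lambda>n. Xs n \<omega>) \<longlonglongrightarrow> x \<omega>" "\<And>\<omega>. \<omega> \<in> \<Omega> - N \<Longrightarrow> (\<lambda>n. Ys n \<omega>) \<longlonglongrightarrow> y \<omega>"
proof -
  \<comment> \<open>The real limit is \<open>real_of_ereal\<close> of the element; this conversion
    loses nothing where the element is finite.\<close>
  have *: "\<exists>N\<in>sets M. E (indicator N) = 0 \<and>
      (\<forall>\<omega>\<in>\<Omega> - N. X \<omega> = ereal (real_of_ereal (X \<omega>)) \<and> (\<lambda>n. Xs n \<omega>) \<longlonglongrightarrow> real_of_ereal (X \<omega>))"
    if R: "represents Xs X" for Xs X
  proof -
    obtain N where N: "N \<in> sets M" "E (indicator N) = 0"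
      and lim: "\<forall>\<omega>\<in>\<Omega> - N. \<bar>X \<omega>\<bar> \<noteq> \<infinity> \<and> (\<lambda>n. ereal (Xs n \<omega>)) \<longlonglongrightarrow> X \<omega>"
      using represents_finite[OF R] by (elim bexE conjE)
    have "X \<omega> = ereal (real_of_ereal (X \<omega>)) \<and> (\<lambda>n. Xs n \<omega>) \<longlonglongrightarrow> real_of_ereal (X \<omega>)"
      if "\<omega> \<in> \<Omega> - N" for \<omega>
      using bspec[OF lim that] by (cases "X \<omega>") auto
    then show ?thesis using N by blast
  qed
  obtain N where N: "N \<in> sets M" "E (indicator N) = 0"
    and X: "\<forall>\<omega>\<in>\<Omega> - N. X \<omega> = ereal (real_of_ereal (X \<omega>)) \<and> (\<lambda>n. Xs n \<omega>) \<longlonglongrightarrow> real_of_ereal (X \<omega>)"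
    using *[OF assms(1)] by (elim bexE conjE)
  obtain N' where N': "N' \<in> sets M" "E (indicator N') = 0"
    and Y: "\<forall>\<omega>\<in>\<Omega> - N'. Y \<omega> = ereal (real_of_ereal (Y \<omega>)) \<and> (\<lambda>n. Ys n \<omega>) \<longlonglongrightarrow> real_of_ereal (Y \<omega>)"
    using *[OF assms(2)] by (elim bexE conjE)
  show thesis
  proof (rule that[of "N \<union> N'" "\<lambda>\<omega>. real_of_ereal (X \<omega>)" "\<lambda>\<omega>. real_of_ereal (Y \<omega>)"])
    show "N \<union> N' \<in> sets M" "E (indicator (N \<union> N')) = 0" using N N' null_Un by blast+
  qed (use X Y in simp_all)
qed

text \<open>The order of the limits need not hold between the approximants. The excess of
  \<open>Xs n\<close> over \<open>Ys n\<close> is, however, a Cauchy sequence tending to 0 off a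
  null set, so its expectation vanishes in the limit by \<open>cauchy_null_limit\<close>.\<close>

lemma E1_mono:
  assumes "X \<in> L1" "Y \<in> L1" and le: "\<And>\<omega>. \<omega> \<in> \<Omega> \<Longrightarrow> X \<omega> \<le> Y \<omega>"
  shows "E1 X \<le> E1 Y"
proof -
  obtain Xs Ys where R: "represents Xs X" "represents Ys Y" using assms unfolding L1_def by blast
  note Xs = representsD(1)[OF R(1)] and Ys = representsD(1)[OF R(2)]
  obtain N x y where N: "N \<in> sets M" "E (indicator N) = 0"
    and x: "\<And>\<omega>. \<omega> \<in> \<Omega> - N \<Longrightarrow> X \<omega> = ereal (x \<omega>)" "\<And>\<omega>. \<omega> \<in> \<Omega> - N \<Longrightarrow> (\<lambda>n. Xs n \<omega>) \<longlonglongrightarrow> x \<omega>"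
    and y: "\<And>\<omega>. \<omega> \<in> \<Omega> - N \<Longrightarrow> Y \<omega> = ereal (y \<omega>)" "\<And>\<omega>. \<omega> \<in> \<Omega> - N \<Longrightarrow> (\<lambda>n. Ys n \<omega>) \<longlonglongrightarrow> y \<omega>"
    using represents_common_null[OF R] by metis
  \<comment> \<open>This is the positive part of \<open>Xs n - Ys n\<close>, written with an
    absolute value because that form shows membership in \<open>H\<close> from its closure
    rules.\<close>
  define Z where "Z n \<omega> = 1/2 * ((Xs n \<omega> - Ys n \<omega>) + \<bar>Xs n \<omega> - Ys n \<omega>\<bar>)" for n \<omega>
  have Zmax: "Z n \<omega> = max (Xs n \<omega> - Ys n \<omega>) 0" for n \<omega>
    by (simp add: Z_def max_def abs_if)
  have Z: "Z n \<in> H" for n unfolding Z_def[abs_def] by (intro H_scale H_add H_abs H_diff Xs Ys)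
  have "(\<lambda>n. E (\<lambda>\<omega>. \<bar>Z n \<omega>\<bar>)) \<longlonglongrightarrow> 0"
  proof (rule cauchy_null_limit[OF Z _ N])
    show "\<exists>k. \<forall>m\<ge>k. \<forall>n\<ge>k. E (\<lambda>\<omega>. \<bar>Z m \<omega> - Z n \<omega>\<bar>) < e" if "e > 0" for e
    proof (rule Cauchy_dominated[OF R Z _ that])
      fix m n \<omega>
      have "\<bar>max a 0 - max b 0\<bar> \<le> \<bar>a - b\<bar>" for a b :: real by (simp add: max_def)
      then have "\<bar>Z m \<omega> - Z n \<omega>\<bar> \<le> \<bar>(Xs m \<omega> - Ys m \<omega>) - (Xs n \<omega> - Ys n \<omega>)\<bar>"
        unfolding Zmax .
      then show "\<bar>Z m \<omega> - Z n \<omega>\<bar> \<le> \<bar>Xs m \<omega> - Xs n \<omega>\<bar> + \<bar>Ys m \<omega> - Ys n \<omega>\<bar>" by linarith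
    qed
    fix \<omega> assume w: "\<omega> \<in> \<Omega> - N"
    have "(\<lambda>n. Z n \<omega>) \<longlonglongrightarrow> max (x \<omega> - y \<omega>) 0"
      unfolding Zmax by (intro tendsto_intros x y w)
    then show "(\<lambda>n. Z n \<omega>) \<longlonglongrightarrow> 0" using le[of \<omega>] x(1)[OF w] y(1)[OF w] w by (simp add: max_def)
  qed
  then have "(\<lambda>n. E (Ys n) + E (\<lambda>\<omega>. \<bar>Z n \<omega>\<bar>)) \<longlonglongrightarrow> E1 Y + 0"
    by (intro tendsto_add represents_limit R)
  moreover have "E (Xs n) \<le> E (Ys n) + E (\<lambda>\<omega>. \<bar>Z n \<omega>\<bar>)" for n
  proof -
    have "E (Xs n) \<le> E (\<lambda>\<omega>. Ys n \<omega> + \<bar>Z n \<omega>\<bar>)"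
      by (intro mono H_add H_abs Xs Ys Z) (simp add: Zmax)
    also have "\<dots> \<le> E (Ys n) + E (\<lambda>\<omega>. \<bar>Z n \<omega>\<bar>)" by (intro subadd H_abs Ys Z)
    finally show ?thesis .
  qed
  ultimately show ?thesis using LIMSEQ_le[OF represents_limit[OF R(1)]] by simp
qed

text \<open>An undefined sum of opposite infinities can occur only on the common null set; elsewhere
  both limits are finite and real limits add.\<close>

lemma represents_add:
  assumes R: "represents Xs X" "represents Ys Y"
  shows "represents (\<lambda>n \<omega>. Xs n \<omega> + Ys n \<omega>) (\<lambda>\<omega>. X \<omega> + Y \<omega>)"
proof -
  note Xs = representsD(1)[OF R(1)] and Ys = representsD(1)[OF R(2)]
  obtain N x y where N: "N \<in> sets M" "E (indicator N) = 0"
    and x: "\<And>\<omega>. \<omega> \<in> \<Omega> - N \<Longrightarrow> X \<omega> = ereal (x \<omega>)" "\<And>\<omega>. \<omega> \<in> \<Omega> - N \<Longrightarrow> (\<lambda>n. Xs n \<omega>) \<longlonglongrightarrow> x \<omega>"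
    and y: "\<And>\<omega>. \<omega> \<in> \<Omega> - N \<Longrightarrow> Y \<omega> = ereal (y \<omega>)" "\<And>\<omega>. \<omega> \<in> \<Omega> - N \<Longrightarrow> (\<lambda>n. Ys n \<omega>) \<longlonglongrightarrow> y \<omega>"
    using represents_common_null[OF R] by metis
  have S: "(\<lambda>\<omega>. Xs n \<omega> + Ys n \<omega>) \<in> H" for n by (intro H_add Xs Ys)
  have "\<exists>k. \<forall>m\<ge>k. \<forall>n\<ge>k. E (\<lambda>\<omega>. \<bar>Xs m \<omega> + Ys m \<omega> - (Xs n \<omega> + Ys n \<omega>)\<bar>) < e" if "e > 0" for e
    by (rule Cauchy_dominated[OF R S _ that]) simp
  moreover have "(\<lambda>n. ereal (Xs n \<omega> + Ys n \<omega>)) \<longlonglongrightarrow> X \<omega> + Y \<omega>" if w: "\<omega> \<in> \<Omega> - N" for \<omega>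
    using tendsto_add[OF x(2)[OF w] y(2)[OF w]] by (simp add: x(1)[OF w] y(1)[OF w])
  ultimately show ?thesis unfolding represents_def using S N by blast
qed

lemma L1_add:
  assumes "X \<in> L1" "Y \<in> L1"
  shows "(\<lambda>\<omega>. X \<omega> + Y \<omega>) \<in> L1"
proof -
  obtain Xs Ys where "represents Xs X" "represents Ys Y" using assms unfolding L1_def by blast
  moreover have "(\<lambda>\<omega>. X \<omega> + Y \<omega>) \<in> borel_measurable M" using assms by (auto simp: L1_def)
  ultimately show ?thesis using represents_add unfolding L1_def by blast
qed

text \<open>Sums of approximants represent the sum, so the inequality on \<open>H\<close> passes to
  the limit.\<close>

lemma E1_subadd:
  assumes "X \<in> L1" "Y \<in> L1"
  shows "E1 (\<lambda>\<omega>. X \<omega> + Y \<omega>) \<le> E1 X + E1 Y"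
proof -
  obtain Xs Ys where R: "represents Xs X" "represents Ys Y" using assms unfolding L1_def by blast
  show ?thesis
    by (rule LIMSEQ_le[OF represents_limit[OF represents_add[OF R]]
          tendsto_add[OF represents_limit[OF R(1)] represents_limit[OF R(2)]]])
      (use subadd R[THEN representsD(1)] in blast)
qed

section \<open>Level sets, splitting and Markov's inequality\<close>

text \<open>These functions come from \<open>H\<close> itself, so \<open>E1\<close> is evaluated by
  \<open>E\<close>. The sign of \<open>c\<close> matters since \<open>E\<close> is only positively
  homogeneous.\<close>

lemma
  assumes "A \<in> sets M" "c \<ge> 0"
  shows L1_simple: "(\<lambda>\<omega>. ereal (c * indicator A \<omega>)) \<in> L1"
    and E1_simple: "E1 (\<lambda>\<omega>. ereal (c * indicator A \<omega>)) = c * E (indicator A)"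
  using H_subset_L1 E1_eq_E scale H_scale indicator_H assms by simp_all

lemma level_set:
  assumes "X \<in> L1"
  shows "{\<omega> \<in> \<Omega>. \<bar>X \<omega>\<bar> \<ge> ereal c} \<in> sets M"
proof -
  have [measurable]: "X \<in> borel_measurable M" using assms by (simp add: L1_def)
  have "{\<omega> \<in> space M. \<bar>X \<omega>\<bar> \<ge> ereal c} \<in> sets M" by measurable
  then show ?thesis by simp
qed

text \<open>Comparison with the zero function, which enters as the simple function with
  \<open>A = {}\<close> and \<open>c = 0\<close>. The sign lets \<open>norm\<close> and
  \<open>dist\<close> be controlled by upper bounds alone.\<close>

lemma E1_indicator_abs_nonneg:
  assumes "X \<in> L1" "A \<in> sets M"
  shows "0 \<le> E1 (\<lambda>\<omega>. indicator A \<omega> * \<bar>X \<omega>\<bar>)"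
  using E1_mono[OF L1_simple[of "{}" 0] L1_indicator_abs[OF assms]] E1_simple[of "{}" 0]
  by (simp flip: zero_ereal_def)

text \<open>The two integrands may differ off \<open>\<Omega>\<close>, so they are not equal as
  total functions; \<open>E1_mono\<close> looks only at points of \<open>\<Omega>\<close> and is
  applied in both directions.\<close>

lemma E1_indicator_space:
  assumes "X \<in> L1"
  shows "E1 (\<lambda>\<omega>. indicator \<Omega> \<omega> * \<bar>X \<omega>\<bar>) = E1 (\<lambda>\<omega>. \<bar>X \<omega>\<bar>)"
  using assms sets.top[of M]
  by (intro antisym E1_mono L1_indicator_abs L1_abs) simp_all

text \<open>Where the absolute value is below \<open>c\<close>, the simple term dominates; elsewhere
  the tail term does so alone, infinite values included.\<close>

lemma E1_indicator_split:
  assumes X: "X \<in> L1" and A: "A \<in> sets M" and c: "c \<ge> 0"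
  shows "E1 (\<lambda>\<omega>. indicator A \<omega> * \<bar>X \<omega>\<bar>) \<le>
    c * E (indicator A) + E1 (\<lambda>\<omega>. indicator {\<omega>\<in>\<Omega>. \<bar>X \<omega>\<bar> \<ge> ereal c} \<omega> * \<bar>X \<omega>\<bar>)"
proof -
  note L = L1_simple[OF A c] L1_indicator_abs[OF X level_set[OF X, of c]]
  have "E1 (\<lambda>\<omega>. indicator A \<omega> * \<bar>X \<omega>\<bar>) \<le> E1 (\<lambda>\<omega>. ereal (c * indicator A \<omega>) +
      indicator {\<omega>\<in>\<Omega>. \<bar>X \<omega>\<bar> \<ge> ereal c} \<omega> * \<bar>X \<omega>\<bar>)"
  proof (intro E1_mono L1_add L L1_indicator_abs X A)
    fix \<omega> assume w: "\<omega> \<in> \<Omega>"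
    show "indicator A \<omega> * \<bar>X \<omega>\<bar> \<le> ereal (c * indicator A \<omega>) +
        indicator {\<omega>\<in>\<Omega>. \<bar>X \<omega>\<bar> \<ge> ereal c} \<omega> * \<bar>X \<omega>\<bar>"
    proof (cases "\<bar>X \<omega>\<bar> \<ge> ereal c")
      case True
      then show ?thesis using w c by (auto simp: indicator_def intro: add_increasing)
    next
      case False
      then show ?thesis by (auto simp: indicator_def not_le)
    qed
  qed
  also have "\<dots> \<le> c * E (indicator A) + E1 (\<lambda>\<omega>. indicator {\<omega>\<in>\<Omega>. \<bar>X \<omega>\<bar> \<ge> ereal c} \<omega> * \<bar>X \<omega>\<bar>)"
    using E1_subadd[OF L] E1_simple[OF A c] by simp
  finally show ?thesis .
qed

text \<open>Turns a bound on the expectations into smallness of the level sets, to which condition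
  (ii) can then be applied.\<close>

lemma E1_Markov:
  assumes X: "X \<in> L1" and c: "c \<ge> 0"
  shows "c * E (indicator {\<omega>\<in>\<Omega>. \<bar>X \<omega>\<bar> \<ge> ereal c}) \<le> E1 (\<lambda>\<omega>. \<bar>X \<omega>\<bar>)"
proof -
  note A = level_set[OF X, of c]
  show ?thesis unfolding E1_simple[OF A c, symmetric]
    by (intro E1_mono L1_simple[OF A c] L1_abs X)
      (auto simp: indicator_def simp flip: zero_ereal_def)
qed

section \<open>The two directions of the equivalence\<close>

text \<open>Extracts one level that works for all of \<open>K\<close>. It is taken positive so that
  it can serve as a divisor.\<close>

lemma uniformly_integrable_tail:
  assumes "uniformly_integrable K" "e > 0"
  obtains c where "c > 0"
    "\<And>X. X \<in> K \<Longrightarrow> E1 (\<lambda>\<omega>. indicator {\<omega>\<in>\<Omega>. \<bar>X \<omega>\<bar> \<ge> ereal c} \<omega> * \<bar>X \<omega>\<bar>) < e"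
proof -
  have "\<forall>\<^sub>F c in at_top. \<forall>X\<in>K.
      dist (E1 (\<lambda>\<omega>. indicator {\<omega>\<in>\<Omega>. \<bar>X \<omega>\<bar> \<ge> ereal c} \<omega> * \<bar>X \<omega>\<bar>)) 0 < e"
    using assms unfolding uniformly_integrable_def uniform_limit_iff by blast
  then have "\<forall>\<^sub>F c in at_top. c > 0 \<and> (\<forall>X\<in>K.
      dist (E1 (\<lambda>\<omega>. indicator {\<omega>\<in>\<Omega>. \<bar>X \<omega>\<bar> \<ge> ereal c} \<omega> * \<bar>X \<omega>\<bar>)) 0 < e)"
    by (intro eventually_conj eventually_gt_at_top)
  then obtain c where "c > 0" "\<forall>X\<in>K.
      dist (E1 (\<lambda>\<omega>. indicator {\<omega>\<in>\<Omega>. \<bar>X \<omega>\<bar> \<ge> ereal c} \<omega> * \<bar>X \<omega>\<bar>)) 0 < e"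
    using eventually_happens' trivial_limit_at_top_linorder by blast
  then show thesis by (intro that[of c]) (auto simp: dist_real_def)
qed

lemma uniformly_integrable_iff:
  assumes K: "K \<subseteq> L1"
  shows "uniformly_integrable K \<longleftrightarrow>
    bounded ((\<lambda>X. E1 (\<lambda>\<omega>. \<bar>X \<omega>\<bar>)) ` K) \<and>
    (\<forall>\<epsilon>>0. \<exists>\<delta>>0. \<forall>A\<in>sets M. E (indicator A) \<le> \<delta> \<longrightarrow>
       (\<forall>X\<in>K. E1 (\<lambda>\<omega>. indicator A \<omega> * \<bar>X \<omega>\<bar>) < \<epsilon>))" (is "_ \<longleftrightarrow> ?bdd \<and> ?cont")
proof (intro iffI conjI)
  assume ui: "uniformly_integrable K"
  \<comment> \<open>Boundedness follows from a single tail level; the tolerance 1 is an arbitrary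
    choice.\<close>
  obtain c where c: "c > 0" "\<And>X. X \<in> K \<Longrightarrow>
      E1 (\<lambda>\<omega>. indicator {\<omega>\<in>\<Omega>. \<bar>X \<omega>\<bar> \<ge> ereal c} \<omega> * \<bar>X \<omega>\<bar>) < 1"
    using uniformly_integrable_tail[OF ui, of 1] by auto
  have O: "\<Omega> \<in> sets M" using sets.top[of M] by simp
  \<comment> \<open>Splitting with \<open>A = \<Omega>\<close> gives a bound that does not depend on
    \<open>X\<close>.\<close>
  have "norm (E1 (\<lambda>\<omega>. \<bar>X \<omega>\<bar>)) \<le> c * E (indicator \<Omega>) + 1" if "X \<in> K" for X
    using E1_indicator_split[OF _ O, of X c] E1_indicator_abs_nonneg[OF _ O, of X] c(1) c(2)[OF that] K that
    by (auto simp: E1_indicator_space subset_iff)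
  then show ?bdd unfolding bounded_iff by blast
next
  assume ui: "uniformly_integrable K"
  show ?cont
  proof (intro allI impI)
    fix e :: real assume "e > 0"
    then have "e / 2 > 0" by simp
    then obtain c where c: "c > 0" "\<And>X. X \<in> K \<Longrightarrow>
        E1 (\<lambda>\<omega>. indicator {\<omega>\<in>\<Omega>. \<bar>X \<omega>\<bar> \<ge> ereal c} \<omega> * \<bar>X \<omega>\<bar>) < e / 2"
      using uniformly_integrable_tail[OF ui] by metis
    \<comment> \<open>The choice of \<open>e / (2 * c)\<close> as delta leaves \<open>e / 2\<close>
      for the simple term; the tail is strictly below \<open>e / 2\<close>, which makes the final
      inequality strict.\<close>
    have "E1 (\<lambda>\<omega>. indicator A \<omega> * \<bar>X \<omega>\<bar>) < e"
      if A: "A \<in> sets M" "E (indicator A) \<le> e / (2 * c)" and X: "X \<in> K" for A X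
    proof -
      have "c * E (indicator A) \<le> e / 2" using A(2) c(1) by (simp add: field_simps)
      then show ?thesis using E1_indicator_split[OF _ A(1), of X c] c(1) c(2)[OF X] K X by fastforce
    qed
    then show "\<exists>\<delta>>0. \<forall>A\<in>sets M. E (indicator A) \<le> \<delta> \<longrightarrow>
        (\<forall>X\<in>K. E1 (\<lambda>\<omega>. indicator A \<omega> * \<bar>X \<omega>\<bar>) < e)"
      using \<open>e > 0\<close> c(1) by (intro exI[of _ "e / (2 * c)"]) auto
  qed
next
  assume *: "?bdd \<and> ?cont"
  obtain B where B: "B > 0" "\<And>X. X \<in> K \<Longrightarrow> norm (E1 (\<lambda>\<omega>. \<bar>X \<omega>\<bar>)) \<le> B"
    using * unfolding bounded_pos by auto
  show "uniformly_integrable K"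
    unfolding uniformly_integrable_def uniform_limit_iff
  proof (intro allI impI)
    fix e :: real assume "e > 0"
    then obtain d where d: "d > 0" "\<And>A X. A \<in> sets M \<Longrightarrow> E (indicator A) \<le> d \<Longrightarrow> X \<in> K \<Longrightarrow>
        E1 (\<lambda>\<omega>. indicator A \<omega> * \<bar>X \<omega>\<bar>) < e"
      using * by meson
    \<comment> \<open>The threshold \<open>B / d\<close> is where Markov's inequality forces every
      level set of every \<open>X\<close> in \<open>K\<close> to have expectation at most
      \<open>d\<close>; condition (ii) is then used with \<open>A\<close> the level set itself,
      which varies with \<open>X\<close>.\<close>
    have "dist (E1 (\<lambda>\<omega>. indicator {\<omega>\<in>\<Omega>. \<bar>X \<omega>\<bar> \<ge> ereal c} \<omega> * \<bar>X \<omega>\<bar>)) 0 < e"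
      if c: "c \<ge> B / d" and X: "X \<in> K" for c X
    proof -
      \<comment> \<open>Since \<open>B\<close> was chosen positive, so are the threshold and
        \<open>c\<close>, and the Markov bound may be divided by \<open>c\<close>.\<close>
      have "c > 0" using c B(1) d(1) by (smt (verit) divide_pos_pos)
      have XL: "X \<in> L1" using X K by blast
      have "c * E (indicator {\<omega>\<in>\<Omega>. \<bar>X \<omega>\<bar> \<ge> ereal c}) \<le> B"
        using E1_Markov[OF XL, of c] B(2)[OF X] \<open>c > 0\<close> by simp
      also have "\<dots> \<le> c * d" using c d(1) by (simp add: field_simps)
      finally have "E (indicator {\<omega>\<in>\<Omega>. \<bar>X \<omega>\<bar> \<ge> ereal c}) \<le> d" using \<open>c > 0\<close> by simp
      then show ?thesis
        using d(2)[OF level_set[OF XL] _ X] E1_indicator_abs_nonneg[OF XL level_set[OF XL], of c]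
        by simp
    qed
    then show "\<forall>\<^sub>F c in at_top. \<forall>X\<in>K.
        dist (E1 (\<lambda>\<omega>. indicator {\<omega>\<in>\<Omega>. \<bar>X \<omega>\<bar> \<ge> ereal c} \<omega> * \<bar>X \<omega>\<bar>)) 0 < e"
      by (intro eventually_mono[OF eventually_ge_at_top[of "B / d"]]) blast
  qed
qed

end

theorem theorem3p1:
  fixes \<Omega> :: "'a set"
    and F :: "nat \<Rightarrow> 'a measure"
    and H :: "('a \<Rightarrow> real) set"
    and \<E> :: "nat \<Rightarrow> ('a \<Rightarrow> real) \<Rightarrow> 'a \<Rightarrow> real"
    and K :: "('a \<Rightarrow> ereal) set"
  assumes "SL_expectation \<Omega> F H \<E>"
    and "K \<subseteq> SL_expectation.L1 \<Omega> F H \<E>"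
  shows "SL_expectation.uniformly_integrable \<Omega> F H \<E> K \<longleftrightarrow>
    bounded ((\<lambda>X. SL_expectation.E1 \<Omega> F H \<E> (\<lambda>\<omega>. \<bar>X \<omega>\<bar>)) ` K) \<and>
    (\<forall>\<epsilon>>0. \<exists>\<delta>>0. \<forall>A\<in>sets (SL_expectation.M \<Omega> F).
       SL_expectation.E \<Omega> \<E> (indicator A) \<le> \<delta> \<longrightarrow>
       (\<forall>X\<in>K. SL_expectation.E1 \<Omega> F H \<E> (\<lambda>\<omega>. indicator A \<omega> * \<bar>X \<omega>\<bar>) < \<epsilon>))"
  by (rule SL_expectation.uniformly_integrable_iff[OF assms])

end
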